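(* Let $\varnothing\ne T\subset\mathbb{R}$, let $(M,d)$ be a proper metric space, and let $\{f_j\}_{j=1}^\infty\subset M^T$ be a sequence of functions which is pointwise relatively compact on $T$ (or, more generally, almost everywhere relatively compact on $T$), satisfying the condition: for every $\eta>0$ there is a measurable set $E_\eta\subset T$ of Lebesgue measure $\mathcal{L}(E_\eta)\le\eta$ such that $$\limsup_{j\to\infty}V_\varepsilon(f_j,T\setminus E_\eta)<\infty\quad\text{for all }\varepsilon>0.$$ Then a subsequence of $\{f_j\}$ converges almost everywhere on $T$ to a function $f\in M^T$ having the following property: given $\eta>0$, there is a measurable set $E'_\eta\subset T$ of Lebesgue measure $\mathcal{L}(E'_\eta)\le\eta$ such that $V_\varepsilon(f,T\setminus E'_\eta)<\infty$ for all $\varepsilon>0$.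
   Context: $M^T$ is the set of all functions $f:T\to M$. For $S\subset T$ and functions $f,g$ from $S$ (or from a set containing $S$) to $M$ put $d_{\infty,S}(f,g)=\sup_{t\in S}d(f(t),g(t))$. The (Jordan) variation of $g:S\to M$ is $V(g,S)=\sup\sum_{i=1}^m d(g(t_i),g(t_{i-1}))\in[0,\infty]$, the supremum being over all $m\in\mathbb{N}$ and all $t_0\le t_1\le\dots\le t_m$ in $S$; $\mathrm{BV}(S;M)=\{g\in M^S:V(g,S)<\infty\}$. For $\varepsilon>0$, the $\varepsilon$-variation of $f$ on $S$ is $$V_\varepsilon(f,S)=\inf\{V(g,S):g\in\mathrm{BV}(S;M),\ d_{\infty,S}(f,g)\le\varepsilon\}\in[0,\infty],\qquad \inf\varnothing=\infty,$$ with $V_\varepsilon(f,\varnothing)=0$. A sequence $\{f_j\}\subset M^T$ is pointwise relatively compact on $T$ if for every $t\in T$ the closure in $M$ of $\{f_j(t):j\in\mathbb{N}\}$ is compact; it is almost everywhere relatively compact on $T$ if this holds for all $t\in T\setminus T_0$ for some $T_0\subset T$ of Lebesgue measure zero. Almost everywhere convergence on $T$ means convergence in $M$ at all points of $T\setminus E$ for some $E\subset T$ of Lebesgue measure zero. A metric space is proper if all of its closed bounded subsets are compact. *)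

theory Defs
  imports "HOL-Analysis.Analysis"
begin

text \<open>
  A function from a set of reals to \<open>M\<close> is represented by a total function of type
  \<open>real \<Rightarrow> 'a\<close>; the notions below depend only on its values on the given set. All
  suprema and infima are taken in \<open>ennreal\<close>, where the supremum of the empty set is \<open>0\<close>
  and its infimum is \<open>\<infinity>\<close>.
\<close>

definition uniform_dist_on :: "real set \<Rightarrow> (real \<Rightarrow> 'a::metric_space) \<Rightarrow> (real \<Rightarrow> 'a) \<Rightarrow> ennreal" where
  "uniform_dist_on S f g = (SUP t\<in>S. ennreal (dist (f t) (g t)))"

definition jordan_variation :: "(real \<Rightarrow> 'a::metric_space) \<Rightarrow> real set \<Rightarrow> ennreal" where
  "jordan_variation g S =
     (SUP (m, t) \<in> {(m::nat, t::nat \<Rightarrow> real). t ` {..m} \<subseteq> S \<and> mono_on {..m} t}.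
        ennreal (\<Sum>i=1..m. dist (g (t i)) (g (t (i - 1)))))"

definition BV :: "real set \<Rightarrow> (real \<Rightarrow> 'a::metric_space) set" where
  "BV S = {g. jordan_variation g S < \<infinity>}"

text \<open>
  No separate clause is needed for the empty set: there every function is an admissible
  competitor of variation \<open>0\<close>, so the infimum is \<open>0\<close>.
\<close>

definition eps_variation :: "real \<Rightarrow> (real \<Rightarrow> 'a::metric_space) \<Rightarrow> real set \<Rightarrow> ennreal" where
  "eps_variation \<epsilon> f S =
     (INF g \<in> {g \<in> BV S. uniform_dist_on S f g \<le> ennreal \<epsilon>}. jordan_variation g S)"

definition pointwise_relatively_compact_on ::
    "real set \<Rightarrow> (nat \<Rightarrow> real \<Rightarrow> 'a::metric_space) \<Rightarrow> bool" where
  "pointwise_relatively_compact_on T f \<longleftrightarrow> (\<forall>t\<in>T. compact (closure (range (\<lambda>j. f j t))))"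

definition ae_relatively_compact_on ::
    "real set \<Rightarrow> (nat \<Rightarrow> real \<Rightarrow> 'a::metric_space) \<Rightarrow> bool" where
  "ae_relatively_compact_on T f \<longleftrightarrow>
     (\<exists>T0\<subseteq>T. T0 \<in> null_sets lebesgue \<and> pointwise_relatively_compact_on (T - T0) f)"

text \<open>
  The set \<open>T\<close> need not be measurable, so the almost everywhere notions are spelled out
  with an exceptional null set instead of the measure-theoretic \<open>AE\<close> quantifier on a
  restricted space.
\<close>

definition ae_converges_on ::
    "real set \<Rightarrow> (nat \<Rightarrow> real \<Rightarrow> 'a::metric_space) \<Rightarrow> (real \<Rightarrow> 'a) \<Rightarrow> bool" where
  "ae_converges_on T f g \<longleftrightarrow>
     (\<exists>E\<subseteq>T. E \<in> null_sets lebesgue \<and> (\<forall>t\<in>T - E. (\<lambda>j. f j t) \<longlonglongrightarrow> g t))"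

end

theory Submission
  imports Defs "HOL-Library.Diagonal_Subsequence"
begin

text \<open>
  The approximate variation of a function is finite for every \<open>\<epsilon>\<close> exactly when, for
  every \<open>e > 0\<close>, the number of jumps is bounded, a jump being a pair of points of \<open>S\<close>
  where the values are more than \<open>e\<close> apart, and only pairs that follow each other on the
  line being counted together. Indeed, a competitor within distance \<open>e\<close> of the function must itself
  vary by at least \<open>e\<close> across every jump larger than \<open>3e\<close>
  (\<open>eps_variation_less_imp_jumps_bounded\<close>). Conversely, the number \<open>k t\<close> of jumps completed
  up to \<open>t\<close> increases with \<open>t\<close> and takes finitely many values, and the function oscillates by
  at most \<open>e\<close> on each level set of \<open>k\<close>; freezing it at one point per level set gives a step function
  of finite variation (\<open>jumps_bounded_imp_eps_variation_finite\<close>).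

  Jump counts behave well in both halves of the theorem. As a jump is defined by strict
  inequalities between finitely many values, a bound on the number of jumps is inherited by
  pointwise limits (\<open>jumps_bounded_by_limit\<close>); this yields the property of the limit function. For the
  selection of a subsequence, the counting functions of the \<open>f j\<close> at each size \<open>1 / (n + 1)\<close> are
  monotone and uniformly bounded, so by Helly's theorem and a diagonal argument one may assume that
  all of them converge pointwise. The limits have finitely many level sets for each \<open>n\<close>; pick a
  point in each. On the resulting countable set a further diagonal subsequence of the \<open>f j\<close>
  converges, by relative compactness. An arbitrary \<open>t\<close> shares a level set with one of the chosen
  points \<open>a\<close>, hence \<open>f j t\<close> stays within \<open>1 / (n + 1)\<close> of the convergent sequence \<open>f j a\<close>, so
  \<open>f j t\<close> is a Cauchy sequence in a compact set (\<open>pointwise_selection\<close>).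

  A last diagonal argument, over exceptional sets of measure at most \<open>1 / (n + 1)\<close>, gives one
  subsequence that converges off their intersection, which is a null set.
\<close>

section \<open>Diagonal sequences and monotone functions\<close>

text \<open>
  All diagonal arguments of the proof are instances of this form: the index type \<open>'b\<close> may consist of
  points of the line or of pairs of a jump size and a point.
\<close>

lemma diagonal_convergent_subsequence:
  fixes F :: "nat \<Rightarrow> 'b \<Rightarrow> 'a::metric_space" and X :: "nat \<Rightarrow> 'b set"
  assumes sel: "\<And>n s. strict_mono (s :: nat \<Rightarrow> nat) \<Longrightarrow>
      \<exists>r :: nat \<Rightarrow> nat. strict_mono r \<and> (\<forall>x\<in>X n. convergent (\<lambda>j. F (s (r j)) x))"
  shows "\<exists>r :: nat \<Rightarrow> nat. strict_mono r \<and> (\<forall>n. \<forall>x\<in>X n. convergent (\<lambda>j. F (r j) x))"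
proof -
  interpret subseqs "\<lambda>n s. \<forall>x\<in>X n. convergent (\<lambda>j. F (s j) x)"
    by standard (use sel in \<open>auto simp: o_def\<close>)
  have "\<forall>x\<in>X n. convergent (\<lambda>j. F (diagseq j) x)" for n
  proof
    fix x assume x: "x \<in> X n"
    have "\<forall>x\<in>X n. convergent (\<lambda>j. F ((diagseq \<circ> (+) (Suc n)) j) x)"
    proof (rule diagseq_holds)
      fix m r s
      assume "strict_mono (r :: nat \<Rightarrow> nat)" "\<forall>x\<in>X m. convergent (\<lambda>j. F (s j) x)"
      then show "\<forall>x\<in>X m. convergent (\<lambda>j. F ((s \<circ> r) j) x)"
        using convergent_subseq_convergent by (fastforce simp: o_def)
    qed
    then have "convergent (\<lambda>j. F (diagseq (j + Suc n)) x)"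
      using x by (simp add: o_def add.commute)
    then show "convergent (\<lambda>j. F (diagseq j) x)"
      by (rule convergent_ignore_initial_segment[THEN iffD1])
  qed
  then show ?thesis using subseq_diagseq by blast
qed

lemma compact_closure_subseq:
  fixes x :: "nat \<Rightarrow> 'a::metric_space"
  assumes "compact (closure (range x))"
  shows "compact (closure (range (\<lambda>j. x (s j))))"
proof -
  have "closure (range (\<lambda>j. x (s j))) \<subseteq> closure (range x)" by (rule closure_mono) auto
  then show ?thesis using assms by (metis closed_closure compact_Int_closed inf.absorb2)
qed

lemma countable_convergent_subsequence:
  fixes F :: "nat \<Rightarrow> 'b \<Rightarrow> 'a::metric_space"
  assumes "countable A"
    and comp: "\<And>x. x \<in> A \<Longrightarrow> compact (closure (range (\<lambda>j. F j x)))"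
  shows "\<exists>r :: nat \<Rightarrow> nat. strict_mono r \<and> (\<forall>x\<in>A. convergent (\<lambda>j. F (r j) x))"
proof (cases "A = {}")
  case True
  then show ?thesis using strict_mono_id by blast
next
  case False
  have "\<exists>r :: nat \<Rightarrow> nat. strict_mono r \<and>
      (\<forall>n. \<forall>x\<in>{from_nat_into A n}. convergent (\<lambda>j. F (r j) x))"
  proof (rule diagonal_convergent_subsequence)
    fix n and s :: "nat \<Rightarrow> nat"
    define x where "x = from_nat_into A n"
    have "x \<in> A" using False by (simp add: x_def from_nat_into)
    then have "seq_compact (closure (range (\<lambda>j. F j x)))"
      using comp compact_eq_seq_compact_metric by blast
    moreover have "\<forall>j. F (s j) x \<in> closure (range (\<lambda>j. F j x))"
      using closure_subset by fastforce
    ultimately obtain l r where "strict_mono (r :: nat \<Rightarrow> nat)" "((\<lambda>j. F (s j) x) \<circ> r) \<longlonglongrightarrow> l"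
      by (metis (no_types, lifting) seq_compactE)
    then show "\<exists>r :: nat \<Rightarrow> nat. strict_mono r \<and>
        (\<forall>x\<in>{from_nat_into A n}. convergent (\<lambda>j. F (s (r j)) x))"
      unfolding x_def convergent_def o_def by blast
  qed
  then show ?thesis
    using from_nat_into_surj[OF \<open>countable A\<close>] by (metis singletonI)
qed

text \<open>
  Helly's theorem with convergence at every point. A subsequence converging on the rationals
  is squeezed to convergence wherever the monotone envelope \<open>G\<close> of its limit is continuous; the remaining
  points are countably many and are handled by one more diagonal subsequence.
\<close>

lemma helly_selection_mono:
  fixes F :: "nat \<Rightarrow> real \<Rightarrow> real"
  assumes mono: "\<And>j. mono (F j)" and bd: "\<And>j x. F j x \<in> {0..C}"
  shows "\<exists>r :: nat \<Rightarrow> nat. strict_mono r \<and> (\<forall>x. convergent (\<lambda>j. F (r j) x))"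
proof -
  have comp: "compact (closure (range (\<lambda>j. F (s j) x)))" for s :: "nat \<Rightarrow> nat" and x
  proof -
    have "range (\<lambda>j. F (s j) x) \<subseteq> {0..C}" using bd by blast
    then show ?thesis
      using bounded_subset compact_closure bounded_closed_interval by blast
  qed
  obtain r where r: "strict_mono (r :: nat \<Rightarrow> nat)"
    and conv: "\<And>q. q \<in> \<rat> \<Longrightarrow> convergent (\<lambda>j. F (r j) q)"
    using countable_convergent_subsequence[OF countable_rat, of F] comp[of id] by auto
  define L where "L q = lim (\<lambda>j. F (r j) q)" for q
  have L: "(\<lambda>j. F (r j) q) \<longlonglongrightarrow> L q" if "q \<in> \<rat>" for q
    using conv[OF that] by (simp add: L_def convergent_LIMSEQ_iff)
  have Lbd: "L q \<le> C" if "q \<in> \<rat>" for q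
    using LIMSEQ_le_const2[OF L[OF that]] bd by (meson atLeastAtMost_iff)
  define G where "G x = Sup (L ` {q\<in>\<rat>. q \<le> x})" for x
  have ne: "{q\<in>\<rat>. q \<le> x} \<noteq> {}" for x :: real
    using Rats_dense_in_real[of "x - 1" x] by force
  have bdd: "bdd_above (L ` {q\<in>\<rat>. q \<le> x})" for x
    using Lbd by (intro bdd_aboveI[of _ C]) auto
  have "mono G"
    unfolding G_def by (intro monoI cSup_subset_mono) (use ne bdd in auto)
  have Lmono: "L p \<le> L q" if "p \<in> \<rat>" "q \<in> \<rat>" "p \<le> q" for p q
    using LIMSEQ_le[OF L[OF that(1)] L[OF that(2)]] mono that(3) by (auto simp: mono_def)
  have GL: "G q = L q" if "q \<in> \<rat>" for q
    unfolding G_def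
    by (rule cSup_eq_maximum) (use that Lmono in auto)
  \<comment> \<open>Rationals \<open>p < x < q\<close> close to \<open>x\<close> squeeze \<open>F (r j) x\<close> between two convergent sequences.\<close>
  have cont: "(\<lambda>j. F (r j) x) \<longlonglongrightarrow> G x" if "isCont G x" for x
  proof (rule LIMSEQ_I)
    fix e :: real assume "e > 0"
    then have "0 < e / 2" by simp
    with that[unfolded continuous_at_eps_delta]
    have "\<exists>d>0. \<forall>y. dist y x < d \<longrightarrow> dist (G y) (G x) < e / 2" by blast
    then obtain d where "d > 0" and d: "\<And>y. dist y x < d \<Longrightarrow> dist (G y) (G x) < e / 2"
      by blast
    obtain p where p: "p \<in> \<rat>" "x - d < p" "p < x" using Rats_dense_in_real[of "x - d" x] \<open>d > 0\<close> by auto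
    obtain q where q: "q \<in> \<rat>" "x < q" "q < x + d" using Rats_dense_in_real[of x "x + d"] \<open>d > 0\<close> by auto
    have gp: "\<bar>L p - G x\<bar> < e / 2" and gq: "\<bar>L q - G x\<bar> < e / 2"
      using d[of p] d[of q] p q GL by (auto simp: dist_real_def)
    have "\<forall>\<^sub>F j in sequentially. dist (F (r j) p) (L p) < e / 2"
      "\<forall>\<^sub>F j in sequentially. dist (F (r j) q) (L q) < e / 2"
      using L[OF p(1)] L[OF q(1)] \<open>e > 0\<close> by (auto dest!: tendstoD[of _ _ _ "e/2"])
    then have "\<forall>\<^sub>F j in sequentially. norm (F (r j) x - G x) < e"
    proof eventually_elim
      case (elim j)
      have "F (r j) p \<le> F (r j) x" "F (r j) x \<le> F (r j) q"
        using mono p q by (auto simp: mono_def)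
      then show ?case using elim gp gq unfolding dist_real_def real_norm_def by linarith
    qed
    then show "\<exists>no. \<forall>n\<ge>no. norm (F (r n) x - G x) < e"
      by (simp add: eventually_sequentially)
  qed
  have "countable {x. \<not> isCont G x}"
    using mono_ctble_discont[OF \<open>mono G\<close>] by simp
  then obtain s where s: "strict_mono (s :: nat \<Rightarrow> nat)"
    and "\<And>x. \<not> isCont G x \<Longrightarrow> convergent (\<lambda>j. F (r (s j)) x)"
    using countable_convergent_subsequence[of "{x. \<not> isCont G x}" "\<lambda>j. F (r j)"] comp[of r] by auto
  moreover have "convergent (\<lambda>j. F (r (s j)) x)" if "isCont G x" for x
    using LIMSEQ_subseq_LIMSEQ[OF cont[OF that] s] by (auto simp: convergent_def o_def)
  ultimately have "\<forall>x. convergent (\<lambda>j. F ((r \<circ> s) j) x)" by auto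
  then show ?thesis using strict_mono_o[OF r s] by blast
qed

section \<open>Counting jumps\<close>

text \<open>
  The \<open>m\<close> jumps are listed from right to left: the last one is the pair \<open>u \<le> v\<close>, and the others take
  place before \<open>u\<close>. The inequality \<open>e < dist (g u) (g v)\<close> is strict so that it survives small
  perturbations of \<open>g\<close>.
\<close>

fun has_jumps :: "real \<Rightarrow> (real \<Rightarrow> 'a::metric_space) \<Rightarrow> real set \<Rightarrow> nat \<Rightarrow> real \<Rightarrow> bool" where
  "has_jumps e g S 0 t = True"
| "has_jumps e g S (Suc m) t =
     (\<exists>u\<in>S. \<exists>v\<in>S. u \<le> v \<and> v \<le> t \<and> e < dist (g u) (g v) \<and> has_jumps e g S m u)"

definition jumps_bounded_by :: "nat \<Rightarrow> real \<Rightarrow> (real \<Rightarrow> 'a::metric_space) \<Rightarrow> real set \<Rightarrow> bool" where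
  "jumps_bounded_by N e g S \<longleftrightarrow> (\<forall>m t. has_jumps e g S m t \<longrightarrow> m \<le> N)"

text \<open>
  The cap \<open>N\<close> keeps the count finite, monotone in \<open>t\<close> and uniformly bounded for every function. For a
  function with at most \<open>N\<close> jumps it is the true number of jumps; in a sequence, this may fail for
  finitely many members.
\<close>

definition jump_count :: "nat \<Rightarrow> real \<Rightarrow> (real \<Rightarrow> 'a::metric_space) \<Rightarrow> real set \<Rightarrow> real \<Rightarrow> nat" where
  "jump_count N e g S t = Max {m. m \<le> N \<and> has_jumps e g S m t}"

lemma has_jumps_mono: "has_jumps e g S m t \<Longrightarrow> t \<le> t' \<Longrightarrow> has_jumps e g S m t'"
  by (cases m) (auto intro: order_trans)

lemma has_jumps_subset: "has_jumps e g S m t \<Longrightarrow> S \<subseteq> S' \<Longrightarrow> has_jumps e g S' m t"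
proof (induction m arbitrary: t)
  case (Suc m)
  then show ?case unfolding has_jumps.simps by (meson subsetD)
qed simp

lemma jumps_bounded_by_subset:
  "jumps_bounded_by N e g S' \<Longrightarrow> S \<subseteq> S' \<Longrightarrow> jumps_bounded_by N e g S"
  unfolding jumps_bounded_by_def using has_jumps_subset by blast

lemma jump_count_greatest: "m \<le> N \<Longrightarrow> has_jumps e g S m t \<Longrightarrow> m \<le> jump_count N e g S t"
  unfolding jump_count_def by (rule Max_ge) auto

lemma jump_count_attained:
  "jump_count N e g S t \<le> N" "has_jumps e g S (jump_count N e g S t) t"
proof -
  have "{m. m \<le> N \<and> has_jumps e g S m t} \<noteq> {}" by (force intro: exI[of _ 0])
  then have "jump_count N e g S t \<in> {m. m \<le> N \<and> has_jumps e g S m t}"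
    unfolding jump_count_def by (intro Max_in) auto
  then show "jump_count N e g S t \<le> N" "has_jumps e g S (jump_count N e g S t) t" by auto
qed

lemma mono_jump_count: "mono (jump_count N e g S)"
  by (intro monoI jump_count_greatest)
     (use jump_count_attained has_jumps_mono in blast)+

text \<open>
  Two points further apart than \<open>e\<close> in value would form one more jump, and the count would increase
  from the left point to the right one.
\<close>

lemma jump_count_eq_imp_dist_le:
  assumes "jumps_bounded_by N e g S" "s \<in> S" "t \<in> S"
    and eq: "jump_count N e g S s = jump_count N e g S t"
  shows "dist (g s) (g t) \<le> e"
proof -
  have *: "dist (g u) (g v) \<le> e"
    if "u \<le> v" "u \<in> S" "v \<in> S" "jump_count N e g S u = jump_count N e g S v" for u v
  proof (rule ccontr)
    assume "\<not> dist (g u) (g v) \<le> e"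
    then have "e < dist (g u) (g v)" by simp
    then have J: "has_jumps e g S (Suc (jump_count N e g S u)) v"
      unfolding has_jumps.simps
      using that(1-3) jump_count_attained(2)[where N=N and t=u] by (meson order_refl)
    then have "Suc (jump_count N e g S u) \<le> N"
      using assms(1) unfolding jumps_bounded_by_def by blast
    then show False using jump_count_greatest[OF _ J] that(4) by fastforce
  qed
  show ?thesis
    using *[of s t] *[of t s] assms by (metis dist_commute linear)
qed

text \<open>
  Having \<open>m\<close> jumps is witnessed by finitely many strict inequalities, each of which persists along
  a pointwise convergent sequence.
\<close>

lemma eventually_has_jumps:
  assumes "\<And>t. t \<in> S \<Longrightarrow> (\<lambda>j. f j t) \<longlonglongrightarrow> g t" and "has_jumps e g S m t"
  shows "\<forall>\<^sub>F j in sequentially. has_jumps e (f j) S m t"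
  using assms(2)
proof (induction m arbitrary: t)
  case (Suc m)
  then obtain u v where uv: "u \<in> S" "v \<in> S" "u \<le> v" "v \<le> t" "e < dist (g u) (g v)"
    and "has_jumps e g S m u" by auto
  then have "\<forall>\<^sub>F j in sequentially. has_jumps e (f j) S m u" using Suc.IH by blast
  moreover have "\<forall>\<^sub>F j in sequentially. e < dist (f j u) (f j v)"
    by (rule order_tendstoD(1)[OF tendsto_dist[OF assms(1)[OF uv(1)] assms(1)[OF uv(2)]] uv(5)])
  ultimately show ?case by eventually_elim (use uv in auto)
qed simp

lemma jumps_bounded_by_limit:
  assumes "\<And>t. t \<in> S \<Longrightarrow> (\<lambda>j. f j t) \<longlonglongrightarrow> g t"
    and "\<forall>\<^sub>F j in sequentially. jumps_bounded_by N e (f j) S"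
  shows "jumps_bounded_by N e g S"
  unfolding jumps_bounded_by_def
proof (intro allI impI)
  fix m t assume "has_jumps e g S m t"
  then have "\<forall>\<^sub>F j in sequentially. has_jumps e (f j) S m t"
    by (intro eventually_has_jumps[of S f g] assms(1))
  with assms(2) have "\<forall>\<^sub>F j in sequentially. m \<le> N"
    by eventually_elim (auto simp: jumps_bounded_by_def)
  then show "m \<le> N" by simp
qed

section \<open>Jumps and approximate variation\<close>

lemma uniform_dist_on_le_iff:
  assumes "e \<ge> 0"
  shows "uniform_dist_on S f g \<le> ennreal e \<longleftrightarrow> (\<forall>t\<in>S. dist (f t) (g t) \<le> e)"
  using assms by (simp add: uniform_dist_on_def SUP_le_iff ennreal_le_iff)

text \<open>
  Any partition of \<open>S\<close> up to \<open>u\<close> can be prolonged by the two points \<open>u\<close> and \<open>v\<close>. This is the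
  part of the additivity of the variation that makes successive jumps add up.
\<close>

lemma jordan_variation_add_dist_le:
  assumes "u \<in> S" "v \<in> S" "u \<le> v"
  shows "jordan_variation h (S \<inter> {..u}) + ennreal (dist (h u) (h v)) \<le> jordan_variation h (S \<inter> {..v})"
proof -
  define I where "I = {(m::nat, t::nat \<Rightarrow> real). t ` {..m} \<subseteq> S \<inter> {..u} \<and> mono_on {..m} t}"
  define V where "V = (\<lambda>(m::nat, t::nat \<Rightarrow> real). ennreal (\<Sum>i=1..m. dist (h (t i)) (h (t (i - 1)))))"
  have "(0, \<lambda>_. u) \<in> I" using assms by (auto simp: I_def mono_on_def)
  then have "I \<noteq> {}" by blast
  have "jordan_variation h (S \<inter> {..u}) + ennreal (dist (h u) (h v))
      = (SUP x\<in>I. V x + ennreal (dist (h u) (h v)))"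
    using \<open>I \<noteq> {}\<close> by (simp add: ennreal_SUP_add_left jordan_variation_def I_def V_def case_prod_unfold)
  also have "\<dots> \<le> jordan_variation h (S \<inter> {..v})"
  proof (rule SUP_least, clarify)
    fix m t assume "(m, t) \<in> I"
    then have t: "\<And>i. i \<le> m \<Longrightarrow> t i \<in> S" "\<And>i. i \<le> m \<Longrightarrow> t i \<le> u" "mono_on {..m} t"
      by (auto simp: I_def)
    define t' where "t' i = (if i \<le> m then t i else if i = Suc m then u else v)" for i
    have sum: "(\<Sum>i=1..Suc (Suc m). dist (h (t' i)) (h (t' (i - 1))))
        = (\<Sum>i=1..m. dist (h (t i)) (h (t (i - 1)))) + dist (h u) (h (t m)) + dist (h v) (h u)"
    proof -
      have "(\<Sum>i=1..m. dist (h (t' i)) (h (t' (i - 1)))) = (\<Sum>i=1..m. dist (h (t i)) (h (t (i - 1))))"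
        by (rule sum.cong) (auto simp: t'_def)
      then show ?thesis by (simp add: t'_def)
    qed
    have "t' ` {..Suc (Suc m)} \<subseteq> S \<inter> {..v}" "mono_on {..Suc (Suc m)} t'"
      using t assms by (auto simp: t'_def mono_on_def intro: order_trans)
    then have V': "ennreal (\<Sum>i=1..Suc (Suc m). dist (h (t' i)) (h (t' (i - 1)))) \<le> jordan_variation h (S \<inter> {..v})"
      unfolding jordan_variation_def by (intro SUP_upper2[of "(Suc (Suc m), t')"]) auto
    have "V (m, t) + ennreal (dist (h u) (h v))
        = ennreal ((\<Sum>i=1..m. dist (h (t i)) (h (t (i - 1)))) + dist (h u) (h v))"
      by (simp add: V_def ennreal_plus sum_nonneg)
    also have "\<dots> \<le> ennreal (\<Sum>i=1..Suc (Suc m). dist (h (t' i)) (h (t' (i - 1))))"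
      unfolding sum by (intro ennreal_leI) (simp add: dist_commute)
    also note V'
    finally show "V (m, t) + ennreal (dist (h u) (h v)) \<le> jordan_variation h (S \<inter> {..v})" .
  qed
  finally show ?thesis .
qed

lemma jordan_variation_mono: "S \<subseteq> S' \<Longrightarrow> jordan_variation h S \<le> jordan_variation h S'"
  unfolding jordan_variation_def by (rule SUP_subset_mono) auto

text \<open>
  Replacing \<open>g\<close> by \<open>h\<close> shifts each of the two values at a jump by at most \<open>e\<close>, so at least \<open>e\<close> of
  a jump larger than \<open>3 * e\<close> remains.
\<close>

lemma has_jumps_imp_jordan_variation_ge:
  assumes close: "\<And>t. t \<in> S \<Longrightarrow> dist (g t) (h t) \<le> e"
    and "0 \<le> e" and "has_jumps (3 * e) g S m t"
  shows "ennreal (m * e) \<le> jordan_variation h (S \<inter> {..t})"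
  using assms(3)
proof (induction m arbitrary: t)
  case (Suc m)
  then obtain u v where uv: "u \<in> S" "v \<in> S" "u \<le> v" "v \<le> t" "3 * e < dist (g u) (g v)"
    and "has_jumps (3 * e) g S m u" by auto
  have "dist (g u) (g v) \<le> dist (g u) (h u) + dist (h u) (h v) + dist (g v) (h v)"
    by metric
  then have "e \<le> dist (h u) (h v)" using uv close[OF uv(1)] close[OF uv(2)] by linarith
  then have "ennreal (Suc m * e) \<le> ennreal (m * e) + ennreal (dist (h u) (h v))"
    using \<open>0 \<le> e\<close> by (simp add: algebra_simps flip: ennreal_plus)
  also have "\<dots> \<le> jordan_variation h (S \<inter> {..u}) + ennreal (dist (h u) (h v))"
    using Suc.IH[OF \<open>has_jumps (3 * e) g S m u\<close>] by (rule add_right_mono)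
  also have "\<dots> \<le> jordan_variation h (S \<inter> {..v})"
    by (rule jordan_variation_add_dist_le[OF uv(1-3)])
  also have "\<dots> \<le> jordan_variation h (S \<inter> {..t})"
    using uv(4) by (intro jordan_variation_mono) auto
  finally show ?case .
qed simp

lemma eps_variation_less_imp_jumps_bounded:
  assumes "0 < e" "0 \<le> C" and "eps_variation e g S < ennreal C"
  shows "jumps_bounded_by (nat \<lceil>C / e\<rceil>) (3 * e) g S"
  unfolding jumps_bounded_by_def
proof (intro allI impI)
  obtain h where h: "uniform_dist_on S g h \<le> ennreal e" "jordan_variation h S < ennreal C"
    using assms(3) unfolding eps_variation_def by (auto simp: INF_less_iff)
  fix m t assume "has_jumps (3 * e) g S m t"
  then have "ennreal (m * e) \<le> jordan_variation h (S \<inter> {..t})"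
    using has_jumps_imp_jordan_variation_ge h(1) \<open>0 < e\<close>
    by (metis less_imp_le uniform_dist_on_le_iff)
  also have "\<dots> \<le> jordan_variation h S" by (rule jordan_variation_mono) auto
  also note h(2)
  finally have "m * e < C" using assms by (simp add: ennreal_less_iff)
  then have "m \<le> C / e" using \<open>0 < e\<close> by (simp add: pos_le_divide_eq)
  then show "m \<le> nat \<lceil>C / e\<rceil>" by linarith
qed

lemma limsup_eps_variation_imp_jumps_bounded:
  assumes "0 < e" and "limsup (\<lambda>j. eps_variation (e / 3) (f j) S) < \<infinity>"
  shows "\<exists>N. \<forall>\<^sub>F j in sequentially. jumps_bounded_by N e (f j) S"
proof -
  obtain C where C: "limsup (\<lambda>j. eps_variation (e / 3) (f j) S) < ennreal (real C)"
    using assms(2) by (metis ennreal_Ex_less_of_nat infinity_ennreal_def ennreal_of_nat_eq_real_of_nat)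
  have "\<forall>\<^sub>F j in sequentially. eps_variation (e / 3) (f j) S < ennreal (real C)"
    by (rule Limsup_lessD[OF C])
  then have "\<forall>\<^sub>F j in sequentially. jumps_bounded_by (nat \<lceil>real C / (e / 3)\<rceil>) e (f j) S"
    by eventually_elim
       (use eps_variation_less_imp_jumps_bounded[of "e / 3" "real C"] \<open>0 < e\<close> in simp)
  then show ?thesis by blast
qed

text \<open>
  The competitor \<open>h\<close> is constant on the level sets of the jump count \<open>k\<close>, with the value of \<open>g\<close> at a
  representative of the level. It takes at most \<open>N + 1\<close> values, so its variation is controlled by the
  total increase of \<open>k\<close> times the diameter \<open>D\<close> of this finite set of values.
\<close>

lemma jumps_bounded_imp_eps_variation_finite:
  assumes "0 < e" and N: "jumps_bounded_by N e g S"
  shows "eps_variation e g S < \<infinity>"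
proof -
  define k where "k = jump_count N e g S"
  define rep where "rep m = (SOME s. s \<in> S \<and> k s = m)" for m
  define h where "h t = g (rep (k t))" for t
  have rep: "rep (k t) \<in> S \<and> k (rep (k t)) = k t" if "t \<in> S" for t
    unfolding rep_def by (rule someI[of _ t]) (use that in simp)
  have close: "dist (g t) (h t) \<le> e" if "t \<in> S" for t
    unfolding h_def using rep[OF that] that
    by (intro jump_count_eq_imp_dist_le[OF N]) (auto simp: k_def)
  have kN: "k t \<le> N" for t by (simp add: k_def jump_count_attained)
  define D where "D = diameter ((g \<circ> rep) ` {..N})"
  have "0 \<le> D" by (simp add: D_def diameter_ge_0 finite_imp_bounded)
  have D: "dist (h a) (h b) \<le> D * (real (k a) - real (k b))" if "b \<le> a" for a b
  proof (cases "k a = k b")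
    case False
    have "k b \<le> k a" unfolding k_def by (rule monoD[OF mono_jump_count that])
    with False have "1 \<le> real (k a) - real (k b)" by linarith
    moreover have "dist (h a) (h b) \<le> D"
      unfolding D_def h_def using kN by (intro diameter_bounded_bound) auto
    ultimately show ?thesis
      using mult_left_mono[of 1 "real (k a) - real (k b)" D] \<open>0 \<le> D\<close> by simp
  qed (simp add: h_def)
  have "jordan_variation h S \<le> ennreal (D * N)"
    unfolding jordan_variation_def
  proof (rule SUP_least, clarify)
    fix m :: nat and t :: "nat \<Rightarrow> real"
    assume t: "mono_on {..m} t"
    have "(\<Sum>i=1..m. dist (h (t i)) (h (t (i - 1))))
        \<le> (\<Sum>i=1..m. D * (real (k (t i)) - real (k (t (i - 1)))))"
      by (intro sum_mono D mono_onD[OF t]) auto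
    also have "\<dots> = D * (real (k (t m)) - real (k (t 0)))"
      using sum_telescope''[of 0 m "\<lambda>i. real (k (t i))"] by (simp flip: sum_distrib_left)
    also have "\<dots> \<le> D * N"
      using kN[of "t m"] by (intro mult_left_mono \<open>0 \<le> D\<close>) linarith
    finally show "ennreal (\<Sum>i=1..m. dist (h (t i)) (h (t (i - 1)))) \<le> ennreal (D * N)"
      by (rule ennreal_leI)
  qed
  then have fin: "jordan_variation h S < \<infinity>" by (rule le_less_trans) simp
  have "eps_variation e g S \<le> jordan_variation h S"
    unfolding eps_variation_def
    by (rule INF_lower) (use close fin \<open>0 < e\<close> in \<open>auto simp: BV_def uniform_dist_on_le_iff\<close>)
  with fin show ?thesis by (rule le_less_trans[rotated])
qed

section \<open>Pointwise and almost everywhere selection\<close>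

text \<open>
  A selection principle of Helly type for metric space valued functions on an arbitrary set of reals.
  The bound on the number of jumps may depend on the jump size, and the index from which it holds may too.
\<close>

lemma pointwise_selection:
  fixes f :: "nat \<Rightarrow> real \<Rightarrow> 'a::metric_space"
  assumes comp: "\<And>t. t \<in> S \<Longrightarrow> compact (closure (range (\<lambda>j. f j t)))"
    and jumps: "\<And>e. 0 < e \<Longrightarrow> \<exists>N. \<forall>\<^sub>F j in sequentially. jumps_bounded_by N e (f j) S"
  shows "\<exists>r :: nat \<Rightarrow> nat. strict_mono r \<and> (\<forall>t\<in>S. convergent (\<lambda>j. f (r j) t))"
proof -
  define e where "e n = 1 / real (Suc n)" for n
  have e_pos: "0 < e n" for n by (simp add: e_def)
  obtain N where N: "\<And>n. \<forall>\<^sub>F j in sequentially. jumps_bounded_by (N n) (e n) (f j) S"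
    using jumps[OF e_pos] by metis
  define k where "k n j = jump_count (N n) (e n) (f j) S" for n j
  have "\<exists>r :: nat \<Rightarrow> nat. strict_mono r \<and>
      (\<forall>n. \<forall>x\<in>{n} \<times> UNIV. convergent (\<lambda>j. (\<lambda>j (n, t). real (k n j t)) (r j) x))"
  proof (rule diagonal_convergent_subsequence)
    fix n and s :: "nat \<Rightarrow> nat"
    have "mono (\<lambda>t. real (k n (s j) t))" for j
      by (auto simp: k_def intro!: monoI monoD[OF mono_jump_count])
    moreover have "real (k n (s j) t) \<in> {0..real (N n)}" for j t
      by (simp add: k_def jump_count_attained)
    ultimately show "\<exists>r :: nat \<Rightarrow> nat. strict_mono r \<and>
      (\<forall>x\<in>{n} \<times> UNIV. convergent (\<lambda>j. (\<lambda>j (n, t). real (k n j t)) (s (r j)) x))"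
      using helly_selection_mono[of "\<lambda>j t. real (k n (s j) t)" "real (N n)"] by simp
  qed
  then obtain r where r: "strict_mono (r :: nat \<Rightarrow> nat)"
    and conv: "\<And>n t. convergent (\<lambda>j. real (k n (r j) t))" by auto
  \<comment> \<open>A convergent sequence of natural numbers is eventually constant; \<open>K n t\<close> is its final value.\<close>
  define K where "K n t = (LEAST m. \<forall>\<^sub>F j in sequentially. k n (r j) t = m)" for n t
  have K: "\<forall>\<^sub>F j in sequentially. k n (r j) t = K n t" for n t
  proof -
    have "Cauchy (\<lambda>j. real (k n (r j) t))" using conv by (rule convergent_Cauchy)
    then obtain J where J: "\<And>i j. i \<ge> J \<Longrightarrow> j \<ge> J \<Longrightarrow> dist (real (k n (r i) t)) (real (k n (r j) t)) < 1"
      unfolding Cauchy_def by (metis zero_less_one)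
    have "k n (r j) t = k n (r J) t" if "j \<ge> J" for j
      using J[OF that order_refl] by (auto simp: dist_real_def)
    then have "\<forall>\<^sub>F j in sequentially. k n (r j) t = k n (r J) t"
      unfolding eventually_sequentially by blast
    then show ?thesis unfolding K_def by (rule LeastI)
  qed
  define rep where "rep n m = (SOME s. s \<in> S \<and> K n s = m)" for n m
  have rep: "rep n (K n t) \<in> S" "K n (rep n (K n t)) = K n t" if "t \<in> S" for n t
  proof -
    have "rep n (K n t) \<in> S \<and> K n (rep n (K n t)) = K n t"
      unfolding rep_def by (rule someI[of _ t]) (use that in simp)
    then show "rep n (K n t) \<in> S" "K n (rep n (K n t)) = K n t" by auto
  qed
  \<comment> \<open>One point from each level set of each \<open>K n\<close>. For a number \<open>m\<close> outside the range of \<open>K n\<close> on \<open>S\<close>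
    the choice \<open>rep n m\<close> is arbitrary, hence the intersection with \<open>S\<close>.\<close>
  define A where "A = S \<inter> range (\<lambda>(n, m). rep n m)"
  have "countable A" by (simp add: A_def)
  have compr: "compact (closure (range (\<lambda>j. f (r j) t)))" if "t \<in> S" for t
    by (rule compact_closure_subseq[OF comp[OF that]])
  obtain s where s: "strict_mono (s :: nat \<Rightarrow> nat)"
    and convA: "\<And>t. t \<in> A \<Longrightarrow> convergent (\<lambda>j. f (r (s j)) t)"
    using countable_convergent_subsequence[OF \<open>countable A\<close>, of "\<lambda>j. f (r j)"] compr
    by (auto simp: A_def)
  have "convergent (\<lambda>j. f (r (s j)) t)" if "t \<in> S" for t
  proof -
    have "Cauchy (\<lambda>j. f (r (s j)) t)"
      unfolding Cauchy_altdef2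
    proof (intro allI impI)
      fix d :: real assume "0 < d"
      then obtain n where n: "e n < d / 3"
        using nat_approx_posE[of "d / 3"] by (auto simp: e_def)
      define a where "a = rep n (K n t)"
      have a: "a \<in> A" "a \<in> S" "K n a = K n t"
        using rep[OF that, of n] by (auto simp: a_def A_def)
      have "strict_mono (\<lambda>j. r (s j))" using strict_mono_o[OF r s] by (simp add: o_def)
      have "\<forall>\<^sub>F j in sequentially. k n (r (s j)) t = K n t" "\<forall>\<^sub>F j in sequentially. k n (r (s j)) a = K n t"
        using eventually_subseq[OF s K[of n t]] eventually_subseq[OF s K[of n a]] a(3) by simp_all
      moreover have "\<forall>\<^sub>F j in sequentially. jumps_bounded_by (N n) (e n) (f (r (s j))) S"
        by (rule eventually_subseq[OF \<open>strict_mono (\<lambda>j. r (s j))\<close> N])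
      ultimately have "\<forall>\<^sub>F j in sequentially. dist (f (r (s j)) t) (f (r (s j)) a) \<le> e n"
        by eventually_elim (use jump_count_eq_imp_dist_le that a(2) in \<open>metis k_def\<close>)
      then obtain J where J: "\<And>j. j \<ge> J \<Longrightarrow> dist (f (r (s j)) t) (f (r (s j)) a) \<le> e n"
        unfolding eventually_sequentially by blast
      obtain J' where J': "\<And>i j. i \<ge> J' \<Longrightarrow> j \<ge> J' \<Longrightarrow> dist (f (r (s i)) a) (f (r (s j)) a) < d / 3"
        using convergent_Cauchy[OF convA[OF a(1)]] \<open>0 < d\<close> unfolding Cauchy_def
        by (metis divide_pos_pos zero_less_numeral)
      define M where "M = max J J'"
      have "dist (f (r (s j)) t) (f (r (s M)) t) < d" if "j \<ge> M" for j
      proof -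
        have "dist (f (r (s j)) t) (f (r (s M)) t) \<le> dist (f (r (s j)) t) (f (r (s j)) a)
            + dist (f (r (s j)) a) (f (r (s M)) a) + dist (f (r (s M)) t) (f (r (s M)) a)"
          by metric
        then show ?thesis
          using J[of j] J[of M] J'[of j M] that n unfolding M_def by force
      qed
      then show "\<exists>M. \<forall>j\<ge>M. dist (f (r (s j)) t) (f (r (s M)) t) < d" by blast
    qed
    moreover have "complete (closure (range (\<lambda>j. f j t)))"
      using comp[OF that] by (rule compact_imp_complete)
    moreover have "\<forall>j. f (r (s j)) t \<in> closure (range (\<lambda>j. f j t))"
      using closure_subset by fastforce
    ultimately show ?thesis unfolding complete_def convergent_def by metis
  qed
  then show ?thesis using strict_mono_o[OF r s] by (auto simp: o_def)
qed

theorem theorem4p14: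
  fixes T :: "real set" and f :: "nat \<Rightarrow> real \<Rightarrow> 'a::metric_space"
  assumes "T \<noteq> {}"
    and proper: "\<And>S :: 'a set. closed S \<Longrightarrow> bounded S \<Longrightarrow> compact S"
    and "pointwise_relatively_compact_on T f \<or> ae_relatively_compact_on T f"
    and "\<And>\<eta>::real. \<eta> > 0 \<Longrightarrow>
           \<exists>E\<in>sets lebesgue. E \<subseteq> T \<and> emeasure lebesgue E \<le> ennreal \<eta> \<and>
             (\<forall>\<epsilon>>0. limsup (\<lambda>j. eps_variation \<epsilon> (f j) (T - E)) < \<infinity>)"
  shows "\<exists>(r :: nat \<Rightarrow> nat) (g :: real \<Rightarrow> 'a).
           strict_mono r \<and> ae_converges_on T (\<lambda>k. f (r k)) g \<and>
           (\<forall>\<eta>::real. \<eta> > 0 \<longrightarrow>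
              (\<exists>E\<in>sets lebesgue. E \<subseteq> T \<and> emeasure lebesgue E \<le> ennreal \<eta> \<and>
                 (\<forall>\<epsilon>>0. eps_variation \<epsilon> g (T - E) < \<infinity>)))"
proof -
  have "\<exists>T0\<subseteq>T. T0 \<in> null_sets lebesgue \<and> pointwise_relatively_compact_on (T - T0) f"
    using assms(3) unfolding ae_relatively_compact_on_def
    by (metis Diff_empty empty_subsetI null_sets.empty_sets)
  then obtain T0 where T0: "T0 \<subseteq> T" "T0 \<in> null_sets lebesgue"
    and comp: "\<And>t. t \<in> T - T0 \<Longrightarrow> compact (closure (range (\<lambda>j. f j t)))"
    unfolding pointwise_relatively_compact_on_def by blast
  define c where "c n = 1 / real (Suc n)" for n
  have "\<forall>n. \<exists>E\<in>sets lebesgue. E \<subseteq> T \<and> emeasure lebesgue E \<le> ennreal (c n) \<and>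
      (\<forall>\<epsilon>>0. limsup (\<lambda>j. eps_variation \<epsilon> (f j) (T - E)) < \<infinity>)"
    by (intro allI assms(4)) (simp add: c_def)
  then obtain E where E: "\<And>n. E n \<in> sets lebesgue" "\<And>n. E n \<subseteq> T"
      "\<And>n. emeasure lebesgue (E n) \<le> ennreal (c n)"
    and lim: "\<And>n \<epsilon>. 0 < \<epsilon> \<Longrightarrow> limsup (\<lambda>j. eps_variation \<epsilon> (f j) (T - E n)) < \<infinity>"
    by metis
  define S where "S n = T - (E n \<union> T0)" for n
  have jumps: "\<exists>N. \<forall>\<^sub>F j in sequentially. jumps_bounded_by N e (f j) (S n)" if "0 < e" for e n
  proof -
    have "limsup (\<lambda>j. eps_variation (e / 3) (f j) (T - E n)) < \<infinity>"
      by (rule lim) (use that in simp)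
    then obtain N where "\<forall>\<^sub>F j in sequentially. jumps_bounded_by N e (f j) (T - E n)"
      using limsup_eps_variation_imp_jumps_bounded[OF \<open>0 < e\<close>] by blast
    then have "\<forall>\<^sub>F j in sequentially. jumps_bounded_by N e (f j) (S n)"
      by (rule eventually_mono) (auto simp: S_def intro: jumps_bounded_by_subset)
    then show ?thesis by blast
  qed
  have "\<exists>r :: nat \<Rightarrow> nat. strict_mono r \<and> (\<forall>n. \<forall>t\<in>S n. convergent (\<lambda>j. f (r j) t))"
  proof (rule diagonal_convergent_subsequence)
    fix n and s :: "nat \<Rightarrow> nat" assume s: "strict_mono s"
    show "\<exists>r :: nat \<Rightarrow> nat. strict_mono r \<and> (\<forall>t\<in>S n. convergent (\<lambda>j. f (s (r j)) t))"
    proof (rule pointwise_selection)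
      fix t assume "t \<in> S n"
      then have "compact (closure (range (\<lambda>j. f j t)))" using comp by (auto simp: S_def)
      then show "compact (closure (range (\<lambda>j. f (s j) t)))" by (rule compact_closure_subseq)
    next
      fix e :: real assume "0 < e"
      then obtain N where "\<forall>\<^sub>F j in sequentially. jumps_bounded_by N e (f j) (S n)"
        using jumps by blast
      then show "\<exists>N. \<forall>\<^sub>F j in sequentially. jumps_bounded_by N e (f (s j)) (S n)"
        by (intro exI) (rule eventually_subseq[OF s])
    qed
  qed
  then obtain r where r: "strict_mono (r :: nat \<Rightarrow> nat)"
    and conv: "\<And>n t. t \<in> S n \<Longrightarrow> convergent (\<lambda>j. f (r j) t)" by blast
  define g where "g t = lim (\<lambda>j. f (r j) t)" for t
  have g: "(\<lambda>j. f (r j) t) \<longlonglongrightarrow> g t" if "t \<in> S n" for n t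
    using conv[OF that] by (simp add: g_def convergent_LIMSEQ_iff)
  have ae: "ae_converges_on T (\<lambda>k. f (r k)) g"
    unfolding ae_converges_on_def
  proof (intro exI conjI ballI)
    show "(\<Inter>n. E n) \<union> T0 \<subseteq> T" using E(2) T0(1) by blast
    have meas: "(\<Inter>n. E n) \<in> sets lebesgue" using E(1) by (intro sets.countable_INT) auto
    have "emeasure lebesgue (\<Inter>n. E n) \<le> 0"
    proof (rule ennreal_le_epsilon)
      fix d :: real assume "0 < d"
      then obtain n where "c n < d" using nat_approx_posE[OF \<open>0 < d\<close>] by (auto simp: c_def)
      have "emeasure lebesgue (\<Inter>n. E n) \<le> emeasure lebesgue (E n)"
        using E(1) by (intro emeasure_mono) auto
      also have "\<dots> \<le> ennreal d"
        using E(3)[of n] \<open>c n < d\<close> by (meson ennreal_leI less_imp_le order_trans)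
      finally show "emeasure lebesgue (\<Inter>n. E n) \<le> 0 + ennreal d" by simp
    qed
    then show "(\<Inter>n. E n) \<union> T0 \<in> null_sets lebesgue"
      using meas T0(2) by (intro null_sets.Un) (auto simp: null_sets_def)
    fix t assume "t \<in> T - ((\<Inter>n. E n) \<union> T0)"
    then obtain n where "t \<in> S n" by (auto simp: S_def)
    then show "(\<lambda>k. f (r k) t) \<longlonglongrightarrow> g t" by (rule g)
  qed
  have "\<exists>E\<in>sets lebesgue. E \<subseteq> T \<and> emeasure lebesgue E \<le> ennreal \<eta> \<and>
      (\<forall>\<epsilon>>0. eps_variation \<epsilon> g (T - E) < \<infinity>)" if "0 < \<eta>" for \<eta> :: real
  proof -
    obtain n where n: "c n < \<eta>" using nat_approx_posE[OF \<open>0 < \<eta>\<close>] by (auto simp: c_def)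
    have "emeasure lebesgue (E n \<union> T0) = emeasure lebesgue (E n)"
      by (rule emeasure_Un_null_set[OF E(1) T0(2)])
    also have "\<dots> \<le> ennreal \<eta>"
      using E(3)[of n] n by (meson ennreal_leI less_imp_le order_trans)
    finally have "emeasure lebesgue (E n \<union> T0) \<le> ennreal \<eta>" .
    moreover have "eps_variation \<epsilon> g (S n) < \<infinity>" if "0 < \<epsilon>" for \<epsilon>
    proof -
      obtain N where "\<forall>\<^sub>F j in sequentially. jumps_bounded_by N \<epsilon> (f j) (S n)"
        using jumps[OF \<open>0 < \<epsilon>\<close>] by blast
      then have "jumps_bounded_by N \<epsilon> g (S n)"
        by (intro jumps_bounded_by_limit[OF g] eventually_subseq[OF r])
      then show ?thesis by (rule jumps_bounded_imp_eps_variation_finite[OF that])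
    qed
    moreover have "E n \<union> T0 \<in> sets lebesgue" "E n \<union> T0 \<subseteq> T"
      using E(1,2) T0 by (auto simp: null_sets_def)
    ultimately show ?thesis unfolding S_def by blast
  qed
  then show ?thesis using r ae by blast
qed

end
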